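(* Let $P$ be a finite poset, let $\omega$ be a labeling of $P$, and let $x,y\in P$ be incomparable elements. Then \begin{align*} F_P &= F_{P|x\leq y}+F_{P|y\leq x}-F_{P|x=y},\\ \Omega_{P,\omega} &= \Omega_{P|x\leq y,\,\omega}+\Omega_{P|y\leq x,\,\omega},\\ K_{P,\omega} &= K_{P|x<y,\,\omega}+K_{P|y\leq x,\,\omega}. \end{align*}
   Context: All posets are finite; $[m]=\{1,\dots,m\}$. $F_P(m)$ is the number of order-preserving maps $f:P\to[m]$ (i.e. $f(a)\le f(b)$ whenever $a\le b$ in $P$); it is a polynomial in $m$. A labeling of $P$ is a bijection $\omega:P\to[|P|]$. A $(P,\omega)$-partition is a map $f$ from $P$ to the positive integers such that $f(a)\le f(b)$ whenever $a\le b$, and $f(a)<f(b)$ whenever $a<b$ and $\omega(a)>\omega(b)$. $\Omega_{P,\omega}(m)$ is the number of $(P,\omega)$-partitions with values in $[m]$. The multivariate generating function is $K_{P,\omega}=\sum_f x_1^{|f^{-1}(1)|}x_2^{|f^{-1}(2)|}\cdots$, a formal power series in variables $x_1,x_2,\dots$, the sum being over all $(P,\omega)$-partitions $f$. For incomparable $x,y\in P$: $P|x\le y$ is the poset on the same elements obtained by adding the relation $x\le y$ and all relations implied by transitivity (in the second identity it carries the same labeling $\omega$). $P|x=y$ is the poset obtained by identifying $x$ and $y$ to a single element $v$ (so, for example, $z\le v$ iff $z\le x$ or $z\le y$ in $P$, with all further relations implied by transitivity). In the third identity, a labeled poset is viewed as a system of weak and strict order relations. $(P,\omega)|x<y$ denotes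 this system with the added strict relation $x<y$ (and everything implied by transitivity), and $(P,\omega)|y\le x$ denotes it with the added weak relation $y\le x$ (and everything implied by transitivity). These systems need not come from labeled posets, but $K$ is still defined as the same sum, taken over all maps $f$ to the positive integers satisfying the system: that is, over all $(P,\omega)$-partitions $f$ with $f(x)<f(y)$, respectively $f(y)\le f(x)$. *)

theory Defs
  imports Main "HOL-Library.FuncSet" "HOL-Library.Function_Algebras" "HOL-Library.Poly_Mapping"
begin

text \<open>
  A finite poset is a finite carrier \<open>P\<close> with its order relation \<open>r\<close> (the set of all pairs
  \<open>(a, b)\<close> with \<open>a \<le> b\<close>), that is, \<^term>\<open>finite P\<close> and \<^term>\<open>partial_order_on P r\<close>. Maps on
  \<open>P\<close> are extensional functions, so that counting them is meaningful.
\<close>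

definition order_poly :: "'a set \<Rightarrow> 'a rel \<Rightarrow> nat \<Rightarrow> int" where
  "order_poly P r m =
     int (card {f \<in> P \<rightarrow>\<^sub>E {1..m}. monotone_on P (\<lambda>a b. (a, b) \<in> r) (\<le>) f})"

definition is_labeling :: "'a set \<Rightarrow> ('a \<Rightarrow> nat) \<Rightarrow> bool" where
  "is_labeling P \<omega> \<longleftrightarrow> bij_betw \<omega> P {1..card P}"

definition pw_partitions :: "'a set \<Rightarrow> 'a rel \<Rightarrow> ('a \<Rightarrow> nat) \<Rightarrow> ('a \<Rightarrow> nat) set" where
  "pw_partitions P r \<omega> =
     {f \<in> P \<rightarrow>\<^sub>E {1..}.
        (\<forall>(a, b)\<in>r. f a \<le> f b) \<and>
        (\<forall>(a, b)\<in>r. a \<noteq> b \<and> \<omega> a > \<omega> b \<longrightarrow> f a < f b)}"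

definition pw_count :: "'a set \<Rightarrow> 'a rel \<Rightarrow> ('a \<Rightarrow> nat) \<Rightarrow> nat \<Rightarrow> int" where
  "pw_count P r \<omega> m = int (card {f \<in> pw_partitions P r \<omega>. f ` P \<subseteq> {1..m}})"


text \<open>
  A formal power series in \<open>x\<^sub>1, x\<^sub>2, \<dots>\<close> is its coefficient function on monomials, a monomial
  being a finitely supported exponent vector; addition is pointwise.
  The exponent of \<open>x\<^sub>i\<close> in the monomial of \<open>f\<close> is \<open>|f\<^sup>-\<^sup>1(i)|\<close> (finitely supported when \<open>P\<close> is
  finite). A formal sum of series is taken coefficientwise; it makes sense when each monomial
  occurs in only finitely many of the summands, see \<open>finite_monomial_occurrences\<close> below.
\<close>

type_synonym power_series = "(nat \<Rightarrow>\<^sub>0 nat) \<Rightarrow> int"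

definition map_exponents :: "'a set \<Rightarrow> ('a \<Rightarrow> nat) \<Rightarrow> (nat \<Rightarrow>\<^sub>0 nat)" where
  "map_exponents P f = Abs_poly_mapping (\<lambda>i. card {a \<in> P. f a = i})"

definition monomial_series :: "(nat \<Rightarrow>\<^sub>0 nat) \<Rightarrow> power_series" where
  "monomial_series \<alpha> = (\<lambda>\<beta>. if \<beta> = \<alpha> then 1 else 0)"

definition formal_sum :: "('b \<Rightarrow> power_series) \<Rightarrow> 'b set \<Rightarrow> power_series" where
  "formal_sum g S = (\<lambda>\<beta>. \<Sum>s\<in>{s \<in> S. g s \<beta> \<noteq> 0}. g s \<beta>)"

definition multivariate_gf :: "'a set \<Rightarrow> ('a \<Rightarrow> nat) set \<Rightarrow> power_series" where
  "multivariate_gf P S = formal_sum (\<lambda>f. monomial_series (map_exponents P f)) S"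

definition pw_gf :: "'a set \<Rightarrow> 'a rel \<Rightarrow> ('a \<Rightarrow> nat) \<Rightarrow> power_series" where
  "pw_gf P r \<omega> = multivariate_gf P (pw_partitions P r \<omega>)"


definition add_le :: "'a rel \<Rightarrow> 'a \<Rightarrow> 'a \<Rightarrow> 'a rel" where
  "add_le r x y = (r \<union> {(x, y)})\<^sup>+"

text \<open>
  The poset \<open>P|x=y\<close>: every element is replaced by its class under the equivalence relation
  identifying \<open>x\<close> with \<open>y\<close>, so the merged element \<open>v\<close> is \<^term>\<open>{x, y}\<close>.
\<close>

definition glue :: "'a \<Rightarrow> 'a \<Rightarrow> 'a \<Rightarrow> 'a set" where
  "glue x y a = (if a = x \<or> a = y then {x, y} else {a})"

definition glue_carrier :: "'a set \<Rightarrow> 'a \<Rightarrow> 'a \<Rightarrow> 'a set set" where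
  "glue_carrier P x y = glue x y ` P"

definition glue_order :: "'a rel \<Rightarrow> 'a \<Rightarrow> 'a \<Rightarrow> 'a set rel" where
  "glue_order r x y = {(glue x y a, glue x y b) | a b. (a, b) \<in> r}\<^sup>+"


text \<open>
  Systems of weak and strict order relations. A relation implied by transitivity is strict if
  some relation in a chain deriving it is strict.
\<close>

record 'a order_system =
  elems :: "'a set"
  weak :: "'a rel"
  strict :: "'a rel"

definition system_solutions :: "'a order_system \<Rightarrow> ('a \<Rightarrow> nat) set" where
  "system_solutions s =
     {f \<in> elems s \<rightarrow>\<^sub>E {1..}.
        (\<forall>(a, b)\<in>weak s. f a \<le> f b) \<and> (\<forall>(a, b)\<in>strict s. f a < f b)}"

definition system_gf :: "'a order_system \<Rightarrow> power_series" where
  "system_gf s = multivariate_gf (elems s) (system_solutions s)"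

definition labeled_system :: "'a set \<Rightarrow> 'a rel \<Rightarrow> ('a \<Rightarrow> nat) \<Rightarrow> 'a order_system" where
  "labeled_system P r \<omega> =
     \<lparr>elems = P, weak = r, strict = {(a, b) \<in> r. a \<noteq> b \<and> \<omega> a > \<omega> b}\<rparr>"

definition system_closure :: "'a order_system \<Rightarrow> 'a order_system" where
  "system_closure s =
     (let R = weak s \<union> strict s in s\<lparr>weak := R\<^sup>+, strict := R\<^sup>* O strict s O R\<^sup>*\<rparr>)"

definition add_strict :: "'a order_system \<Rightarrow> 'a \<Rightarrow> 'a \<Rightarrow> 'a order_system" where
  "add_strict s x y = system_closure (s\<lparr>strict := insert (x, y) (strict s)\<rparr>)"

definition add_weak :: "'a order_system \<Rightarrow> 'a \<Rightarrow> 'a \<Rightarrow> 'a order_system" where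
  "add_weak s x y = system_closure (s\<lparr>weak := insert (x, y) (weak s)\<rparr>)"


lemma lookup_map_exponents:
  assumes "finite P"
  shows "Poly_Mapping.lookup (map_exponents P f) i = card {a \<in> P. f a = i}"
proof -
  have "{i. card {a \<in> P. f a = i} \<noteq> 0} \<subseteq> f ` P"
  proof
    fix i assume "i \<in> {i. card {a \<in> P. f a = i} \<noteq> 0}"
    then have "{a \<in> P. f a = i} \<noteq> {}"
      by (metis (mono_tags) card.empty mem_Collect_eq)
    then show "i \<in> f ` P" by blast
  qed
  then have "finite {i. card {a \<in> P. f a = i} \<noteq> 0}"
    using assms finite_subset by blast
  then show ?thesis
    by (simp add: map_exponents_def Abs_poly_mapping_inverse)
qed

lemma finite_monomial_occurrences:
  assumes "finite P" and "S \<subseteq> P \<rightarrow>\<^sub>E {1..}"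
  shows "finite {f \<in> S. monomial_series (map_exponents P f) \<beta> \<noteq> 0}"
proof (rule finite_subset)
  have "f a \<in> Poly_Mapping.keys \<beta>" if "map_exponents P f = \<beta>" "a \<in> P" for f a
  proof -
    have "a \<in> {b \<in> P. f b = f a}"
      using that by simp
    then have "card {b \<in> P. f b = f a} \<noteq> 0"
      using assms(1) by (auto simp: card_eq_0_iff)
    then show ?thesis
      using that lookup_map_exponents[OF assms(1), of f "f a"] by (simp add: in_keys_iff)
  qed
  then show "{f \<in> S. monomial_series (map_exponents P f) \<beta> \<noteq> 0} \<subseteq> P \<rightarrow>\<^sub>E Poly_Mapping.keys \<beta>"
    using assms(2) by (fastforce simp: monomial_series_def PiE_iff split: if_splits)
  show "finite (P \<rightarrow>\<^sub>E Poly_Mapping.keys \<beta>)"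
    using assms(1) by (simp add: finite_PiE)
qed

lemma pw_gf_eq_system_gf: "pw_gf P r \<omega> = system_gf (labeled_system P r \<omega>)"
proof -
  have "pw_partitions P r \<omega> = system_solutions (labeled_system P r \<omega>)"
    unfolding pw_partitions_def system_solutions_def labeled_system_def by auto
  then show ?thesis
    by (simp add: pw_gf_def system_gf_def labeled_system_def)
qed

lemma partial_order_on_add_le:
  assumes po: "partial_order_on P r" and "x \<in> P" "y \<in> P" and nyx: "(y, x) \<notin> r"
  shows "partial_order_on P (add_le r x y)"
proof -
  note r = partial_order_onD[OF po]
  have "(a, b) \<in> r \<or> ((a, x) \<in> r \<and> (y, b) \<in> r)" if "(a, b) \<in> (r \<union> {(x, y)})\<^sup>+" for a b
    using that
  proof induction
    case (base b)
    then show ?case using r(1) assms(2,3) by (auto simp: refl_on_def)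
  next
    case (step b c)
    then show ?case using r(1,2) assms(2,3) nyx by (auto simp: refl_on_def dest: transD)
  qed
  then have "antisym (add_le r x y)"
    unfolding add_le_def antisym_def using r(2,3) nyx by (metis antisymD transD)
  moreover have "add_le r x y \<subseteq> P \<times> P"
    unfolding add_le_def using r(4) assms(2,3) by (intro trancl_subset_Sigma) auto
  ultimately show ?thesis
    using r(1) by (auto simp: partial_order_on_def preorder_on_def refl_on_def add_le_def)
qed

lemma partial_order_on_glue:
  assumes po: "partial_order_on P r" and "x \<in> P" "y \<in> P"
    and nxy: "(x, y) \<notin> r" and nyx: "(y, x) \<notin> r"
  shows "partial_order_on (glue_carrier P x y) (glue_order r x y)"
proof -
  note r = partial_order_onD[OF po]
  define D where "D a \<longleftrightarrow> (a, x) \<in> r \<or> (a, y) \<in> r" for a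
  define U where "U a \<longleftrightarrow> (x, a) \<in> r \<or> (y, a) \<in> r" for a
  have glue_eq: "glue x y a = glue x y b \<longleftrightarrow> a = b \<or> (a \<in> {x, y} \<and> b \<in> {x, y})" for a b
    by (auto simp: glue_def)
  have DU: "D a" "U a" if "a \<in> {x, y}" for a
    using that r(1) assms(2,3) by (auto simp: D_def U_def refl_on_def)
  have mono: "D a" if "(a, b) \<in> r" "D b" for a b
    using that r(2) unfolding D_def by (meson transD)
  have mono': "U b" if "(a, b) \<in> r" "U a" for a b
    using that r(2) unfolding U_def by (meson transD)
  have mid: "a \<in> {x, y}" if "D a" "U a" for a
    using that r(2,3) nxy nyx unfolding D_def U_def by (metis antisymD insert_iff transD)
  have *: "\<exists>a b. X = glue x y a \<and> Y = glue x y b \<and> ((a, b) \<in> r \<or> D a \<and> U b)"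
    if "(X, Y) \<in> glue_order r x y" for X Y
    using that unfolding glue_order_def
  proof induction
    case (base Y)
    then show ?case by blast
  next
    case (step Y Z)
    then obtain a b b' c where *: "X = glue x y a" "Y = glue x y b" "(a, b) \<in> r \<or> D a \<and> U b"
      "Y = glue x y b'" "Z = glue x y c" "(b', c) \<in> r"
      by auto
    have "(a, c) \<in> r \<or> D a \<and> U c"
    proof (cases "b = b'")
      case True
      then show ?thesis using * r(2) mono' by (meson transD)
    next
      case False
      then have "b \<in> {x, y}" "b' \<in> {x, y}" using *(2,4) glue_eq by auto
      then show ?thesis using *(3,6) DU mono mono' by blast
    qed
    then show ?case using * by blast
  qed
  have "antisym (glue_order r x y)"
  proof (rule antisymI)
    fix X Y assume "(X, Y) \<in> glue_order r x y" "(Y, X) \<in> glue_order r x y"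
    then obtain a b a' b' where **:
      "X = glue x y a" "Y = glue x y b" "(a, b) \<in> r \<or> D a \<and> U b"
      "X = glue x y a'" "Y = glue x y b'" "(b', a') \<in> r \<or> D b' \<and> U a'"
      using * by metis
    have "a = a' \<or> (a \<in> {x, y} \<and> a' \<in> {x, y})" "b = b' \<or> (b \<in> {x, y} \<and> b' \<in> {x, y})"
      using ** glue_eq by metis+
    then have "a = b \<or> (a \<in> {x, y} \<and> b \<in> {x, y})"
      using **(3,6) mid mono mono' DU r(3) by (metis antisymD)
    then show "X = Y" using ** glue_eq by metis
  qed
  moreover have "glue_order r x y \<subseteq> glue_carrier P x y \<times> glue_carrier P x y"
    unfolding glue_order_def glue_carrier_def using r(4) by (intro trancl_subset_Sigma) auto
  moreover have "refl_on (glue_carrier P x y) (glue_order r x y)"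
    using r(1) by (fastforce simp: refl_on_def glue_order_def glue_carrier_def)
  ultimately show ?thesis
    by (auto simp: partial_order_on_def preorder_on_def glue_order_def)
qed

end

theory Submission
  imports Defs
begin

text \<open>
  All three identities sort the maps counted on the left by how they compare the two values
  \<open>f x\<close> and \<open>f y\<close>. Imposing a relation between \<open>x\<close> and \<open>y\<close> on a poset or a system of relations
  selects exactly the maps satisfying the corresponding inequality, because the relations added
  by transitivity already hold for every map that satisfies the generating ones.

  For \<open>F\<^sub>P\<close> the two sets \<open>f x \<le> f y\<close> and \<open>f y \<le> f x\<close> cover all order-preserving maps and overlap in
  those with \<open>f x = f y\<close>, which are the order-preserving maps on the glued poset
  (\<open>bij_betw_glued_maps\<close>); the identity is inclusion-exclusion. For \<open>K\<close> the sets
  \<open>f x < f y\<close> and \<open>f y \<le> f x\<close> partition all solutions, and a formal sum over a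
  disjoint union splits.

  For \<open>\<Omega>\<close> there is something to check: whether an implied relation is strict is decided by the
  labels of its own endpoints, not by the chain deriving it. The two are compatible
  (\<open>pw_partitions_add_le\<close>): a chain whose last label is smaller than its first one has a
  descent at some step, and is strict there. Since \<open>\<omega> x \<noteq> \<omega> y\<close>, exactly one of the added relations
  \<open>x \<le> y\<close> and \<open>y \<le> x\<close> is strict, so the two sets of \<open>(P, \<omega>)\<close>-partitions are complementary.
\<close>

section \<open>Relations implied by transitivity\<close>

lemma le_on_trancl:
  fixes f :: "'a \<Rightarrow> 'b::preorder"
  assumes "\<And>a b. (a, b) \<in> R \<Longrightarrow> f a \<le> f b" and "(a, b) \<in> R\<^sup>+"
  shows "f a \<le> f b"
  using assms(2)
proof induction
  case (base b)
  then show ?case by (rule assms(1))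
next
  case (step b c)
  then show ?case using assms(1) order_trans by metis
qed

lemma le_on_rtrancl:
  fixes f :: "'a \<Rightarrow> 'b::preorder"
  assumes "\<And>a b. (a, b) \<in> R \<Longrightarrow> f a \<le> f b" and "(a, b) \<in> R\<^sup>*"
  shows "f a \<le> f b"
  using assms le_on_trancl[of R f a b] by (auto simp: rtrancl_eq_or_trancl)

text \<open>
  A chain in \<open>r \<union> {(x, y)}\<close> needs the new step at most once: the part between two uses of it
  can be cut out.
\<close>

lemma add_le_iff:
  assumes "refl_on P r" and "trans r" and "x \<in> P" and "y \<in> P"
  shows "(a, b) \<in> add_le r x y \<longleftrightarrow> (a, b) \<in> r \<or> ((a, x) \<in> r \<and> (y, b) \<in> r)"
proof
  assume "(a, b) \<in> add_le r x y"
  then show "(a, b) \<in> r \<or> ((a, x) \<in> r \<and> (y, b) \<in> r)"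
    unfolding add_le_def
  proof induction
    case (base b)
    then show ?case using assms by (auto simp: refl_on_def)
  next
    case (step b c)
    then show ?case using assms by (auto simp: refl_on_def dest: transD)
  qed
next
  have "(x, y) \<in> add_le r x y" "r \<subseteq> add_le r x y" "trans (add_le r x y)"
    by (auto simp: add_le_def)
  then show "(a, b) \<in> add_le r x y" if "(a, b) \<in> r \<or> ((a, x) \<in> r \<and> (y, b) \<in> r)"
    using that by (meson subsetD transD)
qed

section \<open>Order-preserving maps\<close>

definition order_maps :: "'a set \<Rightarrow> 'a rel \<Rightarrow> nat \<Rightarrow> ('a \<Rightarrow> nat) set" where
  "order_maps P r m = {f \<in> P \<rightarrow>\<^sub>E {1..m}. monotone_on P (\<lambda>a b. (a, b) \<in> r) (\<le>) f}"

lemma finite_order_maps: "finite P \<Longrightarrow> finite (order_maps P r m)"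
  unfolding order_maps_def by (simp add: finite_PiE)

lemma glue_eq_iff: "glue x y a = glue x y b \<longleftrightarrow> a = b \<or> a \<in> {x, y} \<and> b \<in> {x, y}"
  by (auto simp: glue_def)

lemma order_maps_add_le:
  assumes "r \<subseteq> P \<times> P" and "x \<in> P" and "y \<in> P"
  shows "order_maps P (add_le r x y) m = {f \<in> order_maps P r m. f x \<le> f y}"
proof -
  have "monotone_on P (\<lambda>a b. (a, b) \<in> add_le r x y) (\<le>) f \<longleftrightarrow>
        monotone_on P (\<lambda>a b. (a, b) \<in> r) (\<le>) f \<and> f x \<le> f y" for f :: "'a \<Rightarrow> nat"
  proof
    assume "monotone_on P (\<lambda>a b. (a, b) \<in> add_le r x y) (\<le>) f"
    then show "monotone_on P (\<lambda>a b. (a, b) \<in> r) (\<le>) f \<and> f x \<le> f y"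
      using assms(2,3) by (auto simp: monotone_on_def add_le_def)
  next
    assume "monotone_on P (\<lambda>a b. (a, b) \<in> r) (\<le>) f \<and> f x \<le> f y"
    then have "f a \<le> f b" if "(a, b) \<in> r \<union> {(x, y)}" for a b
      using that assms(1) by (auto simp: monotone_on_def)
    then show "monotone_on P (\<lambda>a b. (a, b) \<in> add_le r x y) (\<le>) f"
      unfolding add_le_def monotone_on_def by (blast intro: le_on_trancl)
  qed
  then show ?thesis
    by (auto simp: order_maps_def)
qed

text \<open>
  A map on the glued poset is a map on \<open>P\<close> that is constant on the classes of the gluing, i.e. one
  that takes the same value at \<open>x\<close> and \<open>y\<close>; the glued order is generated by the images of the
  relations of \<open>P\<close>, so both notions of order preservation agree.
\<close>

lemma bij_betw_glued_maps:
  assumes "r \<subseteq> P \<times> P" and "x \<in> P" and "y \<in> P"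
  shows "bij_betw (\<lambda>g. \<lambda>a\<in>P. g (glue x y a))
           (order_maps (glue_carrier P x y) (glue_order r x y) m)
           {f \<in> order_maps P r m. f x = f y}"
    (is "bij_betw ?pull ?G ?E")
proof (rule bij_betw_imageI)
  show "inj_on ?pull ?G"
  proof (rule inj_onI)
    fix g h assume gh: "g \<in> ?G" "h \<in> ?G" and eq: "?pull g = ?pull h"
    have "g (glue x y a) = h (glue x y a)" if "a \<in> P" for a
      using fun_cong[OF eq, of a] that by simp
    then show "g = h"
      using gh by (intro PiE_ext[of g "glue_carrier P x y" "\<lambda>_. {1..m}" h])
        (auto simp: order_maps_def glue_carrier_def)
  qed
  show "?pull ` ?G = ?E"
  proof (intro equalityI subsetI)
    fix f assume "f \<in> ?pull ` ?G"
    then obtain g where g: "g \<in> ?G" and f: "f = ?pull g" by blast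
    have "f a \<le> f b" if "a \<in> P" "b \<in> P" "(a, b) \<in> r" for a b
    proof -
      have "(glue x y a, glue x y b) \<in> glue_order r x y"
        using that(3) by (auto simp: glue_order_def)
      then show ?thesis
        using g that by (auto simp: f order_maps_def glue_carrier_def monotone_on_def)
    qed
    moreover have "f \<in> P \<rightarrow>\<^sub>E {1..m}"
      using g by (auto simp: f order_maps_def glue_carrier_def Pi_iff)
    moreover have "f x = f y"
      using assms(2,3) by (simp add: f glue_def)
    ultimately show "f \<in> ?E"
      by (simp add: order_maps_def monotone_on_def)
  next
    fix f assume f: "f \<in> ?E"
    define g where "g = (\<lambda>X\<in>glue_carrier P x y. f (SOME a. a \<in> P \<and> glue x y a = X))"
    have g_glue: "g (glue x y a) = f a" if "a \<in> P" for a
    proof -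
      define b where "b = (SOME b. b \<in> P \<and> glue x y b = glue x y a)"
      have "b \<in> P \<and> glue x y b = glue x y a"
        unfolding b_def by (rule someI_ex) (use that in blast)
      then have "f b = f a"
        using f glue_eq_iff[of x y b a] by auto
      then show ?thesis
        using that by (simp add: g_def b_def glue_carrier_def)
    qed
    have "g X \<le> g Y" if "(X, Y) \<in> glue_order r x y" for X Y
      using that unfolding glue_order_def
    proof (rule le_on_trancl[rotated])
      fix X Y assume "(X, Y) \<in> {(glue x y a, glue x y b) |a b. (a, b) \<in> r}"
      then obtain a b where "X = glue x y a" "Y = glue x y b" "(a, b) \<in> r" by blast
      then show "g X \<le> g Y"
        using assms(1) f by (auto simp: g_glue order_maps_def monotone_on_def)
    qed
    moreover have "g \<in> glue_carrier P x y \<rightarrow>\<^sub>E {1..m}"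
    proof (rule PiE_I)
      fix X assume "X \<in> glue_carrier P x y"
      then obtain a where "a \<in> P" "X = glue x y a" by (auto simp: glue_carrier_def)
      then show "g X \<in> {1..m}"
        using f g_glue by (auto simp: order_maps_def)
    qed (simp add: g_def)
    ultimately have "g \<in> ?G"
      by (simp add: order_maps_def monotone_on_def)
    moreover have "?pull g = f"
    proof
      fix a
      have "f \<in> P \<rightarrow>\<^sub>E {1..m}"
        using f by (simp add: order_maps_def)
      then show "?pull g a = f a"
        using g_glue PiE_arb[of f P _ a] by (cases "a \<in> P") simp_all
    qed
    ultimately show "f \<in> ?pull ` ?G" by (metis image_eqI)
  qed
qed

lemma order_poly_split:
  assumes "finite P" and "r \<subseteq> P \<times> P" and "x \<in> P" and "y \<in> P"
  shows "order_poly P r =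
           order_poly P (add_le r x y) + order_poly P (add_le r y x)
           - order_poly (glue_carrier P x y) (glue_order r x y)"
proof
  fix m
  let ?A = "order_maps P (add_le r x y) m" and ?B = "order_maps P (add_le r y x) m"
  have "?A \<union> ?B = order_maps P r m" "?A \<inter> ?B = {f \<in> order_maps P r m. f x = f y}"
    using assms(2-4) by (auto simp: order_maps_add_le)
  then have "card ?A + card ?B =
             card (order_maps P r m) + card {f \<in> order_maps P r m. f x = f y}"
    using card_Un_Int[of ?A ?B] assms(1) by (simp add: finite_order_maps)
  moreover have "card {f \<in> order_maps P r m. f x = f y} =
                 card (order_maps (glue_carrier P x y) (glue_order r x y) m)"
    using bij_betw_same_card[OF bij_betw_glued_maps[OF assms(2-4)]] by simp
  ultimately show "order_poly P r m =
      (order_poly P (add_le r x y) + order_poly P (add_le r y x)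
       - order_poly (glue_carrier P x y) (glue_order r x y)) m"
    by (simp add: order_poly_def order_maps_def)
qed

section \<open>Partitions of labeled posets\<close>

lemma pw_partitions_iff:
  "f \<in> pw_partitions P r \<omega> \<longleftrightarrow>
     f \<in> P \<rightarrow>\<^sub>E {1..} \<and>
     (\<forall>a b. (a, b) \<in> r \<longrightarrow> f a \<le> f b \<and> (\<omega> b < \<omega> a \<longrightarrow> f a < f b))"
proof -
  have "a \<noteq> b \<and> \<omega> b < \<omega> a \<longleftrightarrow> \<omega> b < \<omega> a" for a b by auto
  then show ?thesis by (auto simp: pw_partitions_def)
qed

text \<open>
  The labels make an implied relation \<open>a \<le> x \<le> y \<le> b\<close> strict only if \<open>\<omega> a > \<omega> b\<close>. Then
  \<open>\<omega> a > \<omega> x\<close>, \<open>\<omega> x > \<omega> y\<close> or \<open>\<omega> y > \<omega> b\<close>, so one of the three steps is strict already.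
\<close>

lemma pw_partitions_add_le:
  assumes "refl_on P r" and "trans r" and "x \<in> P" and "y \<in> P"
  shows "pw_partitions P (add_le r x y) \<omega> =
           {f \<in> pw_partitions P r \<omega>. f x \<le> f y \<and> (\<omega> x > \<omega> y \<longrightarrow> f x < f y)}"
proof (intro equalityI subsetI)
  fix f assume f: "f \<in> pw_partitions P (add_le r x y) \<omega>"
  moreover have "(a, b) \<in> add_le r x y" if "(a, b) \<in> r \<or> a = x \<and> b = y" for a b
    unfolding add_le_def using that by (intro r_into_trancl) blast
  ultimately show "f \<in> {f \<in> pw_partitions P r \<omega>. f x \<le> f y \<and> (\<omega> x > \<omega> y \<longrightarrow> f x < f y)}"
    by (simp add: pw_partitions_iff)
next
  fix f assume f: "f \<in> {f \<in> pw_partitions P r \<omega>. f x \<le> f y \<and> (\<omega> x > \<omega> y \<longrightarrow> f x < f y)}"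
  then have weak: "\<And>a b. (a, b) \<in> r \<Longrightarrow> f a \<le> f b"
    and strict: "\<And>a b. (a, b) \<in> r \<Longrightarrow> \<omega> a > \<omega> b \<Longrightarrow> f a < f b"
    by (simp_all add: pw_partitions_iff)
  have "f a \<le> f b \<and> (\<omega> a > \<omega> b \<longrightarrow> f a < f b)" if "(a, b) \<in> add_le r x y" for a b
  proof -
    consider "(a, b) \<in> r" | "(a, x) \<in> r" "(y, b) \<in> r"
      using \<open>(a, b) \<in> add_le r x y\<close> add_le_iff[OF assms(1-4)] by blast
    then show ?thesis
    proof cases
      case 1
      then show ?thesis using weak strict by blast
    next
      case 2
      have "f a \<le> f x" "f x \<le> f y" "f y \<le> f b"
        using 2 weak f by auto
      moreover have "f a < f x \<or> f x < f y \<or> f y < f b" if "\<omega> a > \<omega> b"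
      proof -
        have "\<omega> a > \<omega> x \<or> \<omega> x > \<omega> y \<or> \<omega> y > \<omega> b"
          using that by linarith
        then show ?thesis using 2 strict f by blast
      qed
      ultimately show ?thesis by fastforce
    qed
  qed
  then show "f \<in> pw_partitions P (add_le r x y) \<omega>"
    using f by (simp add: pw_partitions_iff)
qed

lemma pw_count_split:
  assumes "finite P" and "refl_on P r" and "trans r" and "x \<in> P" and "y \<in> P"
    and "\<omega> x \<noteq> \<omega> y"
  shows "pw_count P r \<omega> = pw_count P (add_le r x y) \<omega> + pw_count P (add_le r y x) \<omega>"
proof
  fix m
  define W where "W s = {f \<in> pw_partitions P s \<omega>. f ` P \<subseteq> {1..m}}" for s
  have count: "pw_count P s \<omega> m = int (card (W s))" for s
    by (simp add: pw_count_def W_def)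
  have "finite (W s)" for s
  proof (rule finite_subset)
    show "W s \<subseteq> P \<rightarrow>\<^sub>E {1..m}"
      by (auto simp: W_def pw_partitions_def PiE_def image_subset_iff)
  qed (simp add: assms(1) finite_PiE)
  moreover have "W r = W (add_le r x y) \<union> W (add_le r y x)"
    and "W (add_le r x y) \<inter> W (add_le r y x) = {}"
    using assms(6) by (auto simp: W_def pw_partitions_add_le assms(2-5))
  ultimately show "pw_count P r \<omega> m = (pw_count P (add_le r x y) \<omega> + pw_count P (add_le r y x) \<omega>) m"
    by (simp add: count card_Un_disjoint)
qed

section \<open>Systems of weak and strict relations\<close>

lemma system_solutions_closure: "system_solutions (system_closure s) = system_solutions s"
proof (intro equalityI subsetI)
  fix f assume f: "f \<in> system_solutions (system_closure s)"
  have "strict s \<subseteq> strict (system_closure s)" "weak s \<subseteq> weak (system_closure s)"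
    by (force simp: system_closure_def Let_def intro!: relcompI)+
  moreover have "elems (system_closure s) = elems s"
    by (simp add: system_closure_def Let_def)
  ultimately show "f \<in> system_solutions s"
    using f by (auto simp: system_solutions_def)
next
  fix f assume f: "f \<in> system_solutions s"
  have step: "f a \<le> f b" if "(a, b) \<in> weak s \<union> strict s" for a b
    using f that by (auto simp: system_solutions_def intro: less_imp_le)
  have "f a < f b"
    if ab: "(a, b) \<in> (weak s \<union> strict s)\<^sup>* O strict s O (weak s \<union> strict s)\<^sup>*" for a b
  proof -
    obtain c d where "(a, c) \<in> (weak s \<union> strict s)\<^sup>*" "(c, d) \<in> strict s"
      "(d, b) \<in> (weak s \<union> strict s)\<^sup>*"
      using ab by blast
    then have "f a \<le> f c" "f c < f d" "f d \<le> f b"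
      using le_on_rtrancl[of "weak s \<union> strict s" f, OF step] f
      by (auto simp: system_solutions_def)
    then show ?thesis by linarith
  qed
  moreover have "f a \<le> f b" if "(a, b) \<in> (weak s \<union> strict s)\<^sup>+" for a b
    using le_on_trancl[of "weak s \<union> strict s" f, OF step] that by blast
  ultimately show "f \<in> system_solutions (system_closure s)"
    using f by (auto simp: system_solutions_def system_closure_def Let_def)
qed

lemma system_solutions_add_strict:
  "system_solutions (add_strict s x y) = {f \<in> system_solutions s. f x < f y}"
  unfolding add_strict_def system_solutions_closure by (auto simp: system_solutions_def)

lemma system_solutions_add_weak:
  "system_solutions (add_weak s x y) = {f \<in> system_solutions s. f x \<le> f y}"
  unfolding add_weak_def system_solutions_closure by (auto simp: system_solutions_def)

lemma multivariate_gf_Un_disjoint: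
  assumes "finite P" and "S \<subseteq> P \<rightarrow>\<^sub>E {1..}" and "T \<subseteq> P \<rightarrow>\<^sub>E {1..}" and "S \<inter> T = {}"
  shows "multivariate_gf P (S \<union> T) = multivariate_gf P S + multivariate_gf P T"
proof
  fix \<beta>
  let ?N = "\<lambda>S. {f \<in> S. monomial_series (map_exponents P f) \<beta> \<noteq> 0}"
  have "?N (S \<union> T) = ?N S \<union> ?N T" by blast
  moreover have "finite (?N S)" "finite (?N T)"
    using finite_monomial_occurrences assms(1-3) by blast+
  moreover have "?N S \<inter> ?N T = {}" using assms(4) by blast
  ultimately show "multivariate_gf P (S \<union> T) \<beta> = (multivariate_gf P S + multivariate_gf P T) \<beta>"
    by (simp add: multivariate_gf_def formal_sum_def sum.union_disjoint)
qed

lemma system_gf_split: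
  assumes "finite (elems s)"
  shows "system_gf s = system_gf (add_strict s x y) + system_gf (add_weak s y x)"
proof -
  have "elems (add_strict s x y) = elems s" "elems (add_weak s y x) = elems s"
    by (simp_all add: add_strict_def add_weak_def system_closure_def Let_def)
  moreover have "system_solutions s =
      system_solutions (add_strict s x y) \<union> system_solutions (add_weak s y x)"
    by (auto simp: system_solutions_add_strict system_solutions_add_weak)
  moreover have "system_solutions (add_strict s x y) \<inter> system_solutions (add_weak s y x) = {}"
    by (auto simp: system_solutions_add_strict system_solutions_add_weak)
  moreover have "system_solutions (add_strict s x y) \<subseteq> elems s \<rightarrow>\<^sub>E {1..}"
    and "system_solutions (add_weak s y x) \<subseteq> elems s \<rightarrow>\<^sub>E {1..}"
    unfolding system_solutions_add_strict system_solutions_add_weak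
    by (auto simp: system_solutions_def)
  ultimately show ?thesis
    using assms by (simp add: system_gf_def multivariate_gf_Un_disjoint)
qed

section \<open>The three identities\<close>

theorem lemma1p1:
  fixes P :: "'a set" and r :: "'a rel" and \<omega> :: "'a \<Rightarrow> nat" and x y :: 'a
  assumes "finite P" and "partial_order_on P r"
    and "is_labeling P \<omega>"
    and "x \<in> P" and "y \<in> P" and "(x, y) \<notin> r" and "(y, x) \<notin> r"
  shows "order_poly P r =
           order_poly P (add_le r x y) + order_poly P (add_le r y x)
           - order_poly (glue_carrier P x y) (glue_order r x y) \<and>
         pw_count P r \<omega> = pw_count P (add_le r x y) \<omega> + pw_count P (add_le r y x) \<omega> \<and>
         pw_gf P r \<omega> =
           system_gf (add_strict (labeled_system P r \<omega>) x y)
           + system_gf (add_weak (labeled_system P r \<omega>) y x)"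
proof (intro conjI)
  note r = partial_order_onD[OF assms(2)]
  show "order_poly P r =
      order_poly P (add_le r x y) + order_poly P (add_le r y x)
      - order_poly (glue_carrier P x y) (glue_order r x y)"
    by (rule order_poly_split) (use assms(1,4,5) r(4) in blast)+
  have "x \<noteq> y"
    using assms(4,6) r(1) by (auto simp: refl_on_def)
  then have "\<omega> x \<noteq> \<omega> y"
    using assms(3-5) by (auto simp: is_labeling_def bij_betw_def inj_on_def)
  then show "pw_count P r \<omega> = pw_count P (add_le r x y) \<omega> + pw_count P (add_le r y x) \<omega>"
    by (intro pw_count_split assms(1,4,5) r(1,2))
  show "pw_gf P r \<omega> =
      system_gf (add_strict (labeled_system P r \<omega>) x y)
      + system_gf (add_weak (labeled_system P r \<omega>) y x)"
    unfolding pw_gf_eq_system_gf using assms(1)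
    by (intro system_gf_split) (simp add: labeled_system_def)
qed

end
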